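(* Let $v:\mathbb{R}\to[0,\infty)$ be a total implied volatility free of static arbitrage, and assume that $v\in C^1(\mathbb{R})$ and $v(k)>0$ for every $k\in\mathbb{R}$. Then there exists a unique strictly positive function $h\in C^0(\mathbb{R})$ such that $v$ is the harmonic mean of $h$, i.e. $$v(k)=\frac{1}{\frac1k\int_0^k\frac{1}{h(y)}\,dy}\qquad\text{for all } k\neq 0,$$ and $v(0)=h(0)$.
   Context: Let $N$ be the standard Gaussian cumulative distribution function. The normalized Black-Scholes call price $c_{\mathrm{BS}}:\mathbb{R}\times[0,\infty)\to[0,\infty)$ is $$c_{\mathrm{BS}}(k,v)=N(d_1(k,v))-e^kN(d_0(k,v))\ \text{ if } v>0,\qquad c_{\mathrm{BS}}(k,0)=(1-e^k)^+,$$ where $d_0(k,v)=-\frac kv-\frac v2$ and $d_1(k,v)=-\frac kv+\frac v2$ for $v>0$. A function $v:\mathbb{R}\to[0,\infty)$ is a total implied volatility free of static arbitrage (arbitrage-free total implied volatility) if the function $K\in(0,\infty)\mapsto C(K):=c_{\mathrm{BS}}\bigl(\log\frac KF,v(\log\frac KF)\bigr)$ is convex and satisfies $\lim_{K\to\infty}C(K)=0$ for some (equivalently, any) $F>0$. *)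

theory Defs
  imports "HOL-Probability.Probability"
begin

definition N_cdf :: "real \<Rightarrow> real" where
  "N_cdf = cdf std_normal_distribution"

definition d0 :: "real \<Rightarrow> real \<Rightarrow> real" where
  "d0 k v = - k / v - v / 2"

definition d1 :: "real \<Rightarrow> real \<Rightarrow> real" where
  "d1 k v = - k / v + v / 2"

(* The price is meant for v \<ge> 0, so the else branch is the case v = 0;
   its value for v < 0 is irrelevant. *)
definition c_BS :: "real \<Rightarrow> real \<Rightarrow> real" where
  "c_BS k v = (if v > 0 then N_cdf (d1 k v) - exp k * N_cdf (d0 k v) else max 0 (1 - exp k))"

definition call_price :: "real \<Rightarrow> (real \<Rightarrow> real) \<Rightarrow> real \<Rightarrow> real" where
  "call_price F v K = c_BS (ln (K / F)) (v (ln (K / F)))"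

definition arbitrage_free :: "(real \<Rightarrow> real) \<Rightarrow> bool" where
  "arbitrage_free v \<longleftrightarrow>
     (\<forall>k. v k \<ge> 0) \<and>
     (\<exists>F>0. convex_on {0<..} (call_price F v) \<and> (call_price F v \<longlongrightarrow> 0) at_top)"

(* The interval integral is oriented, so k < 0 is covered as well. *)
definition is_harmonic_mean_of :: "(real \<Rightarrow> real) \<Rightarrow> (real \<Rightarrow> real) \<Rightarrow> bool" where
  "is_harmonic_mean_of v h \<longleftrightarrow>
     (\<forall>k. k \<noteq> 0 \<longrightarrow> v k = 1 / ((1 / k) * (LBINT y=0..k. 1 / h y))) \<and> v 0 = h 0"

end

theory Submission
  imports Defs
begin

text \<open>
  The defining relation of the harmonic mean says that \<open>k / v k\<close> is the primitive of \<open>1 / h\<close> vanishing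
  at \<open>0\<close>, so uniqueness and the candidate \<open>h = v\<^sup>2 / (v - k v')\<close> are immediate, and everything
  hinges on \<open>v k - k v' k > 0\<close>. The price is convex in the strike and bounded by \<open>1\<close>; hence its
  tangent at \<open>K\<close> has nonpositive slope and meets the axis \<open>K = 0\<close> at height at most \<open>1\<close>. In terms of
  \<open>v\<close> these two facts bound \<open>v'\<close> above and below by Mills ratios at \<open>d0\<close> and \<open>d1\<close>, and the
  estimate \<open>N (- x) \<le> \<phi> x / x\<close> turns the bounds into the required inequality for \<open>k > 0\<close> and
  \<open>k < 0\<close> respectively.
\<close>

section \<open>Integrals with a variable upper limit\<close>

lemma interval_integral_DERIV:
  fixes f :: "real \<Rightarrow> real" and a :: real
  assumes "continuous_on UNIV f"
  shows "((\<lambda>u. LBINT y=a..u. f y) has_real_derivative f x) (at x)"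
proof -
  \<comment> \<open>The margin of 1 puts \<open>x\<close> strictly inside \<open>{l..r}\<close>, so
    the derivative within this interval is the derivative at \<open>x\<close>.\<close>
  define l r where "l = min a x - 1" and "r = max a x + 1"
  have "((\<lambda>u. LBINT y=a..u. f y) has_vector_derivative f x) (at x within {l..r})"
    using assms by (intro interval_integral_FTC2) (auto simp: l_def r_def intro: continuous_on_subset)
  then show ?thesis
    by (simp add: has_real_derivative_iff_has_vector_derivative l_def r_def at_within_Icc_at)
qed

section \<open>The standard normal distribution\<close>

lemma std_normal_density_DERIV:
  "(std_normal_density has_real_derivative - x * std_normal_density x) (at x)"
proof -
  have "((\<lambda>x. c * exp (- x\<^sup>2 / 2)) has_real_derivative - x * (c * exp (- x\<^sup>2 / 2))) (at x)"
    for c :: real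
    by (auto intro!: derivative_eq_intros)
  from this[of "1 / sqrt (2 * pi)"] show ?thesis
    unfolding std_normal_density_def .
qed

lemma continuous_on_std_normal_density: "continuous_on A std_normal_density"
  by (rule DERIV_continuous_on[OF has_field_derivative_at_within[OF std_normal_density_DERIV]])

lemma N_cdf_diff:
  assumes "a \<le> b"
  shows "N_cdf b - N_cdf a = (LBINT y=a..b. std_normal_density y)"
proof -
  interpret real_distribution std_normal_distribution
    by (rule real_dist_normal_dist)
  have "N_cdf b - N_cdf a = measure std_normal_distribution {a<..b}"
  proof (cases "a = b")
    case False
    with assms show ?thesis
      by (simp add: N_cdf_def cdf_diff_eq)
  qed simp
  also have "\<dots> = (\<integral>x. indicator {a<..b} x \<partial>std_normal_distribution)"
    by simp
  also have "\<dots> = (\<integral>x. std_normal_density x * indicator {a<..b} x \<partial>lborel)"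
    by (subst integral_density) auto
  also have "\<dots> = (LBINT y=a..b. std_normal_density y)"
    using assms by (simp add: interval_integral_Ioc set_lebesgue_integral_def mult.commute)
  finally show ?thesis .
qed

lemma N_cdf_DERIV: "(N_cdf has_real_derivative std_normal_density x) (at x)"
proof -
  \<comment> \<open>The base point lies left of \<open>x\<close>, so \<open>{a<..}\<close> is an
    open neighbourhood of \<open>x\<close> on which \<open>N_cdf_diff\<close> applies.\<close>
  define a where "a = x - 1"
  have "((\<lambda>u. LBINT y=a..u. std_normal_density y) has_real_derivative std_normal_density x) (at x)"
    by (rule interval_integral_DERIV[OF continuous_on_std_normal_density])
  then have "((\<lambda>u. N_cdf a + (LBINT y=a..u. std_normal_density y)) has_real_derivative
               std_normal_density x) (at x)"
    by (auto intro!: derivative_eq_intros)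
  then show ?thesis
  proof (rule has_field_derivative_transform_within_open[where S = "{a<..}"])
    fix u assume "u \<in> {a<..}"
    then show "N_cdf a + (LBINT y=a..u. std_normal_density y) = N_cdf u"
      using N_cdf_diff[of a u] by simp
  qed (auto simp: a_def)
qed

lemma N_cdf_bounds: "0 \<le> N_cdf x" "N_cdf x \<le> 1"
  and N_cdf_lim_at_top: "(N_cdf \<longlongrightarrow> 1) at_top"
  and N_cdf_lim_at_bot: "(N_cdf \<longlongrightarrow> 0) at_bot"
proof -
  interpret real_distribution std_normal_distribution
    by (rule real_dist_normal_dist)
  show "0 \<le> N_cdf x" "N_cdf x \<le> 1"
    by (simp_all add: N_cdf_def cdf_nonneg cdf_bounded_prob)
  show "(N_cdf \<longlongrightarrow> 1) at_top" "(N_cdf \<longlongrightarrow> 0) at_bot"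
    by (simp_all add: N_cdf_def cdf_lim_at_top_prob cdf_lim_at_bot)
qed

text \<open>The density is even, so \<open>N_cdf x + N_cdf (- x)\<close> has derivative 0. The
  constant is its limit 1 at infinity.\<close>

lemma N_cdf_minus: "N_cdf (- x) = 1 - N_cdf x"
proof -
  define g where "g = (\<lambda>x. N_cdf x + N_cdf (- x))"
  have "(g has_real_derivative 0) (at x)" for x
    unfolding g_def
    by (auto intro!: derivative_eq_intros DERIV_chain2[OF N_cdf_DERIV] N_cdf_DERIV
             simp: std_normal_density_def)
  then have const: "g y = g x" for y
    using DERIV_isconst_all by blast
  have "(g \<longlongrightarrow> g x) at_top"
    by (intro tendsto_eventually always_eventually allI const)
  moreover have "(g \<longlongrightarrow> 1 + 0) at_top"
    unfolding g_def
    by (intro tendsto_add N_cdf_lim_at_top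
        filterlim_compose[OF N_cdf_lim_at_bot filterlim_uminus_at_bot_at_top])
  ultimately have "g x = 1 + 0"
    using tendsto_unique trivial_limit_at_top_linorder by blast
  then show ?thesis
    by (simp add: g_def)
qed

text \<open>The gap \<open>r\<close> between the two sides has derivative
  \<open>- std_normal_density x / x\<^sup>2\<close> for positive \<open>x\<close>. Hence it
  decreases there to its limit 0 and is nonnegative.\<close>

lemma N_cdf_Mills:
  assumes "x > 0"
  shows "N_cdf (- x) \<le> std_normal_density x / x"
proof -
  define r where "r = (\<lambda>x. std_normal_density x / x - (1 - N_cdf x))"
  have deriv: "(r has_real_derivative - std_normal_density y / y\<^sup>2) (at y)" if "y > 0" for y
    unfolding r_def using that
    by (auto intro!: derivative_eq_intros std_normal_density_DERIV N_cdf_DERIV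
             simp: field_simps power2_eq_square)
  have decr: "r z \<le> r y" if "0 < y" "y \<le> z" for y z
  proof (rule DERIV_nonpos_imp_nonincreasing[OF that(2)])
    fix w assume "y \<le> w" "w \<le> z"
    with that deriv[of w] show "\<exists>d. (r has_real_derivative d) (at w) \<and> d \<le> 0"
      by (intro exI[of _ "- std_normal_density w / w\<^sup>2"]) auto
  qed
  have "((\<lambda>x. std_normal_density x / x) \<longlongrightarrow> 0) at_top"
  proof (rule tendsto_sandwich)
    show "eventually (\<lambda>x. 0 \<le> std_normal_density x / x) at_top"
      using eventually_gt_at_top[of 0] by eventually_elim simp
    show "eventually (\<lambda>x. std_normal_density x / x \<le> (1 / sqrt (2 * pi)) / x) at_top"
      using eventually_gt_at_top[of 0]
      by eventually_elim (auto simp: std_normal_density_def field_simps)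
    show "((\<lambda>x. (1 / sqrt (2 * pi)) / x) \<longlongrightarrow> 0) at_top"
      by (intro tendsto_divide_0[OF tendsto_const] filterlim_at_top_imp_at_infinity filterlim_ident)
  qed auto
  then have "(r \<longlongrightarrow> 0 - (1 - 1)) at_top"
    unfolding r_def by (intro tendsto_intros N_cdf_lim_at_top)
  then have "0 \<le> r x"
    using eventually_mono[OF eventually_ge_at_top[of x] decr[OF assms]]
    by (intro tendsto_upperbound[of r 0 at_top "r x"]) auto
  then show ?thesis
    by (simp add: r_def N_cdf_minus)
qed

section \<open>The Black-Scholes price along the smile\<close>

lemma exp_mult_std_normal_density_d0:
  assumes "v \<noteq> 0"
  shows "exp k * std_normal_density (d0 k v) = std_normal_density (d1 k v)"
proof -
  have "k + - (d0 k v)\<^sup>2 / 2 = - (d1 k v)\<^sup>2 / 2"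
    using assms by (simp add: d0_def d1_def power2_eq_square field_simps)
  then have "exp k * exp (- (d0 k v)\<^sup>2 / 2) = exp (- (d1 k v)\<^sup>2 / 2)"
    by (metis exp_add)
  then show ?thesis
    by (simp add: std_normal_density_def)
qed

lemma c_BS_le_1: "c_BS k v \<le> 1"
proof -
  have "0 \<le> exp k * N_cdf (d0 k v)"
    by (simp add: N_cdf_bounds)
  then show ?thesis
    using N_cdf_bounds(2)[of "d1 k v"] by (simp add: c_BS_def)
qed

text \<open>By \<open>exp_mult_std_normal_density_d0\<close> the contributions of \<open>p\<close>,
  the derivative of \<open>k / v k\<close>, cancel, and the two halves of \<open>v'\<close> add up
  to the vega term.\<close>

lemma c_BS_smile_DERIV:
  assumes pos: "\<And>k. v k > 0" and v': "(v has_real_derivative v') (at k)"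
  shows "((\<lambda>k. c_BS k (v k)) has_real_derivative
           std_normal_density (d1 k (v k)) * v' - exp k * N_cdf (d0 k (v k))) (at k)"
proof -
  define p where "p = (v k - k * v') / (v k)\<^sup>2"
  have nz: "v k \<noteq> 0"
    using pos[of k] by simp
  have q: "((\<lambda>k. k / v k) has_real_derivative p) (at k)"
    by (rule derivative_eq_intros v' refl nz)+ (simp add: p_def power2_eq_square mult.commute)
  have D0: "((\<lambda>k. d0 k (v k)) has_real_derivative - p - v' / 2) (at k)"
    using DERIV_diff[OF DERIV_minus[OF q] DERIV_cdivide[OF v', of 2]] by (simp add: d0_def)
  have D1: "((\<lambda>k. d1 k (v k)) has_real_derivative - p + v' / 2) (at k)"
    using DERIV_add[OF DERIV_minus[OF q] DERIV_cdivide[OF v', of 2]] by (simp add: d1_def)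
  have "((\<lambda>k. N_cdf (d1 k (v k)) - exp k * N_cdf (d0 k (v k))) has_real_derivative
          std_normal_density (d1 k (v k)) * (- p + v' / 2)
          - (exp k * N_cdf (d0 k (v k))
             + (std_normal_density (d0 k (v k)) * (- p - v' / 2)) * exp k)) (at k)"
    by (intro DERIV_diff DERIV_mult DERIV_exp DERIV_chain2[OF N_cdf_DERIV D0]
          DERIV_chain2[OF N_cdf_DERIV D1])
  also have "std_normal_density (d1 k (v k)) * (- p + v' / 2)
          - (exp k * N_cdf (d0 k (v k))
             + (std_normal_density (d0 k (v k)) * (- p - v' / 2)) * exp k)
        = std_normal_density (d1 k (v k)) * v' - exp k * N_cdf (d0 k (v k))"
    unfolding exp_mult_std_normal_density_d0[OF nz, of k, symmetric] by (simp add: field_simps)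
  finally show ?thesis
    by (simp add: c_BS_def pos)
qed

lemma call_price_tangent_bounds:
  fixes v :: "real \<Rightarrow> real"
  assumes free: "arbitrage_free v" and pos: "\<And>k. v k > 0"
    and v': "(v has_real_derivative v') (at k)"
  shows "std_normal_density (d0 k (v k)) * v' \<le> N_cdf (d0 k (v k))"
    and "- std_normal_density (d1 k (v k)) * v' \<le> N_cdf (- d1 k (v k))"
proof -
  obtain F where F: "F > 0" and conv: "convex_on {0<..} (call_price F v)"
    using free unfolding arbitrage_free_def by blast
  define K where "K = F * exp k"
  \<comment> \<open>\<open>D / F\<close> will be the slope of the price in the strike at
    \<open>K\<close>, so the first claim says that this slope is nonpositive.\<close>
  define D where "D = std_normal_density (d0 k (v k)) * v' - N_cdf (d0 k (v k))"
  have K: "K > 0" and lnK: "ln (K / F) = k"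
    using F by (simp_all add: K_def)
  have density: "std_normal_density (d1 k (v k)) = exp k * std_normal_density (d0 k (v k))"
    using exp_mult_std_normal_density_d0[of "v k" k] pos[of k] by simp
  have ln: "((\<lambda>K. ln (K / F)) has_real_derivative 1 / K) (at K)"
    using F K by (auto intro!: derivative_eq_intros)
  have "(call_price F v has_real_derivative
      (std_normal_density (d1 k (v k)) * v' - exp k * N_cdf (d0 k (v k))) * (1 / K)) (at K)"
    unfolding call_price_def
    using DERIV_chain2[OF c_BS_smile_DERIV[OF pos v', folded lnK] ln] by (simp add: lnK)
  moreover have "(std_normal_density (d1 k (v k)) * v' - exp k * N_cdf (d0 k (v k))) * (1 / K) = D / F"
    using F by (simp add: density D_def K_def field_simps)
  ultimately have deriv: "(call_price F v has_real_derivative D / F) (at K)"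
    by simp
  have price: "call_price F v K = N_cdf (d1 k (v k)) - exp k * N_cdf (d0 k (v k))"
    using pos by (simp add: call_price_def lnK c_BS_def)
  \<comment> \<open>The tangent lies below the convex price, which is itself at most 1.\<close>
  have tangent: "call_price F v K + D / F * (L - K) \<le> 1" if "L > 0" for L
  proof -
    have "call_price F v L - call_price F v K \<ge> D / F * (L - K)"
      using K that deriv
      by (intro convex_on_imp_above_tangent[OF conv])
         (auto simp: has_field_derivative_at_within interior_open)
    moreover have "call_price F v L \<le> 1"
      by (simp add: call_price_def c_BS_le_1)
    ultimately show ?thesis
      by simp
  qed
  show "std_normal_density (d0 k (v k)) * v' \<le> N_cdf (d0 k (v k))"
  proof (rule ccontr)
    assume "\<not> ?thesis"
    then have D: "D / F > 0"
      using F by (simp add: D_def)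
    \<comment> \<open>At this strike a rising tangent has gained
      \<open>2 + \<bar>call_price F v K\<bar>\<close>, which lifts it above 1.\<close>
    define L where "L = K + (2 + \<bar>call_price F v K\<bar>) / (D / F)"
    have "L > 0"
      unfolding L_def using K D by (intro add_pos_nonneg divide_nonneg_pos) auto
    moreover have "D / F * (L - K) = 2 + \<bar>call_price F v K\<bar>"
      using D by (auto simp: L_def)
    ultimately show False
      using tangent[of L] by linarith
  qed
  \<comment> \<open>The bound on the tangent is known for positive strikes only, so it passes to the
    intercept by a limit. The intercept equals N(d1) - \<phi>(d1) v', and 1 - N(d1) =
    N(-d1).\<close>
  have "((\<lambda>L. call_price F v K + D / F * (L - K)) \<longlongrightarrow> call_price F v K + D / F * (0 - K)) (at_right 0)"
    by (intro tendsto_intros)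
  then have "call_price F v K + D / F * (0 - K) \<le> 1"
    using tangent by (intro tendsto_upperbound) (auto simp: eventually_at_filter)
  moreover have "D / F * (0 - K) = - (exp k * D)"
    using F by (simp add: K_def)
  ultimately show "- std_normal_density (d1 k (v k)) * v' \<le> N_cdf (- d1 k (v k))"
    by (simp add: price D_def density N_cdf_minus algebra_simps)
qed

section \<open>Positivity of \<open>v k - k * v'\<close>\<close>

lemma arbitrage_free_slope:
  fixes v :: "real \<Rightarrow> real"
  assumes free: "arbitrage_free v" and pos: "\<And>k. v k > 0"
    and v': "(v has_real_derivative v') (at k)"
  shows "v k - k * v' > 0"
proof -
  \<comment> \<open>Used with \<open>x\<close> = |k| / v and \<open>y\<close> = v / 2, where
    \<open>x + y\<close> is -d0 for k > 0 and d1 for k < 0. Mills' estimate gives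
    \<open>c \<le> 1 / (x + y)\<close>, and the positive \<open>y\<close> makes the bound by
    \<open>1 / x\<close> strict.\<close>
  have mills: "c < 1 / x" if "0 < x" "0 < y" "std_normal_density (x + y) * c \<le> N_cdf (- (x + y))" for c x y
  proof -
    have "std_normal_density (x + y) * c \<le> std_normal_density (x + y) / (x + y)"
      using that N_cdf_Mills[of "x + y"] by linarith
    then have "c \<le> 1 / (x + y)"
      by (metis mult_le_cancel_left_pos normal_density_pos times_divide_eq_right mult.right_neutral zero_less_one)
    also have "\<dots> < 1 / x"
      using that by (simp add: field_simps)
    finally show ?thesis .
  qed
  have even: "std_normal_density (- x) = std_normal_density x" for x
    by (simp add: std_normal_density_def)
  consider "k > 0" | "k = 0" | "k < 0"
    by linarith
  then show ?thesis
  proof cases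
    case 1
    have d0: "d0 k (v k) = - (k / v k + v k / 2)"
      by (simp add: d0_def)
    have "v' < 1 / (k / v k)"
      using 1 pos[of k] call_price_tangent_bounds(1)[OF assms]
      by (intro mills[of _ "v k / 2"]) (simp_all only: d0 even, simp_all)
    with 1 show ?thesis
      by (simp add: field_simps)
  next
    case 2
    with pos show ?thesis
      by simp
  next
    case 3
    have d1: "d1 k (v k) = - k / v k + v k / 2"
      by (simp add: d1_def)
    have "- v' < 1 / (- k / v k)"
      using 3 pos[of k] call_price_tangent_bounds(2)[OF assms]
      by (intro mills[of _ "v k / 2"]) (simp_all only: d1, simp_all add: field_simps)
    with 3 show ?thesis
      by (simp add: field_simps)
  qed
qed

section \<open>Harmonic means as primitives\<close>

text \<open>At \<open>k = 0\<close> the integral identity reads 0 = 0, so it can be stated for all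
  \<open>k\<close>. A zero integral at \<open>k \<noteq> 0\<close> fails both sides, since
  \<open>1 / 0 = 0\<close> whereas \<open>v k\<close> is positive.\<close>

lemma is_harmonic_mean_of_iff_primitive:
  assumes "\<And>k. v k > 0"
  shows "is_harmonic_mean_of v h \<longleftrightarrow> (\<forall>k. (LBINT y=0..k. 1 / h y) = k / v k) \<and> v 0 = h 0"
proof -
  have "v k = 1 / (1 / k * I) \<longleftrightarrow> I = k / v k" if "k \<noteq> 0" for k I :: real
    using that assms[of k] by (cases "I = 0") (auto simp: field_simps)
  then show ?thesis
    unfolding is_harmonic_mean_of_def by (metis div_0 interval_integral_endpoints_same zero_ereal_def)
qed

theorem theorem2p4:
  fixes v :: "real \<Rightarrow> real"
  assumes "arbitrage_free v"
    and "v C1_differentiable_on UNIV"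
    and "\<And>k. v k > 0"
  shows "\<exists>!h :: real \<Rightarrow> real.
           continuous_on UNIV h \<and> (\<forall>k. h k > 0) \<and> is_harmonic_mean_of v h"
proof -
  note pos = assms(3)
  obtain v' where v': "\<And>k. (v has_real_derivative v' k) (at k)" and cont': "continuous_on UNIV v'"
    using assms(2) unfolding C1_differentiable_on_def has_real_derivative_iff_has_vector_derivative
    by blast
  have cont: "continuous_on UNIV v"
    by (rule DERIV_continuous_on) (rule v')
  have slope: "v k - k * v' k > 0" for k
    by (rule arbitrage_free_slope[OF assms(1) pos v'])
  \<comment> \<open>This is the reciprocal of the derivative of \<open>k / v k\<close>;
    \<open>slope\<close> makes it positive and continuous.\<close>
  define h where "h = (\<lambda>k. (v k)\<^sup>2 / (v k - k * v' k))"
  have primitive: "((\<lambda>k. k / v k) has_real_derivative 1 / h k) (at k)" for k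
    using pos[of k] slope[of k]
    by (auto intro!: derivative_eq_intros v' simp: h_def field_simps power2_eq_square)
  have h_cont: "continuous_on UNIV h"
    unfolding h_def using slope
    by (intro continuous_intros cont cont') (metis less_irrefl)
  have h_pos: "h k > 0" for k
    using pos[of k] slope[of k] by (simp add: h_def)
  have inv_cont: "continuous_on UNIV (\<lambda>k. 1 / g k)" if "continuous_on UNIV g" "\<forall>k. g k > 0" for g :: "real \<Rightarrow> real"
    using that by (intro continuous_intros) (auto simp: less_imp_neq[symmetric])
  have "(LBINT y=0..k. 1 / h y) = k / v k" for k :: real
  proof -
    have "(LBINT y=ereal 0..ereal k. 1 / h y) = k / v k - 0 / v 0"
      using inv_cont[OF h_cont] h_pos primitive
      by (intro interval_integral_FTC_finite)
         (auto simp: has_real_derivative_iff_has_vector_derivative[symmetric]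
               intro: continuous_on_subset has_field_derivative_at_within)
    then show ?thesis
      by (simp add: zero_ereal_def)
  qed
  moreover have "v 0 = h 0"
    using pos[of 0] by (simp add: h_def power2_eq_square)
  ultimately have "is_harmonic_mean_of v h"
    by (simp add: is_harmonic_mean_of_iff_primitive[OF pos])
  \<comment> \<open>Both \<open>1 / g\<close> and \<open>1 / h\<close> are the derivative of
    \<open>k / v k\<close> at every point, 0 included.\<close>
  moreover have "g = h" if g: "continuous_on UNIV g" "\<forall>k. g k > 0" "is_harmonic_mean_of v g" for g
  proof
    fix k
    have "((\<lambda>k. LBINT y=ereal 0..ereal k. 1 / g y) has_real_derivative 1 / g k) (at k)"
      by (rule interval_integral_DERIV[OF inv_cont[OF g(1,2)]])
    then have "((\<lambda>k. k / v k) has_real_derivative 1 / g k) (at k)"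
      using g(3) by (simp add: is_harmonic_mean_of_iff_primitive[OF pos] zero_ereal_def)
    then have "1 / g k = 1 / h k"
      using primitive DERIV_unique by blast
    then show "g k = h k"
      by simp
  qed
  ultimately show ?thesis
    using h_cont h_pos by blast
qed

end
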